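(* Let $f\colon\mathbb{R}^d\to\mathbb{R}$ be convex and twice differentiable, and let $H>0$ be a constant such that for all $x,y\in\mathbb{R}^d$ $$f(y)\le f(x)+\langle\nabla f(x),y-x\rangle+\tfrac12\langle\nabla^2 f(x)(y-x),y-x\rangle+\tfrac{H}{3}\|y-x\|^3,$$ $$\|\nabla f(y)-\nabla f(x)-\nabla^2 f(x)(y-x)\|\le H\|x-y\|^2.$$ Let $x^0\in\mathbb{R}^d$. Assume that there is a point $x^*\in\mathbb{R}^d$ with $f(x^* )=f^*:=\min_{x\in\mathbb{R}^d}f(x)$, and a constant $D>0$ such that $\|x-x^*\|\le D$ for every $x$ satisfying $f(x)\le f(x^0)$. Let the sequence $(x^k)_{k\ge 0}$ be generated from $x^0$ by $$x^{k+1}=x^k-\bigl(\nabla^2 f(x^k)+\lambda_k\mathbf{I}\bigr)^{-1}\nabla f(x^k),\qquad \lambda_k=\sqrt{H\|\nabla f(x^k)\|},\qquad k=0,1,2,\dots,$$ where the matrices $\nabla^2 f(x^k)+\lambda_k\mathbf{I}$ are assumed invertible for all $k$, so that the iteration is defined. Then $$f(x^k)-f^*=\mathcal{O}\left(\frac{1}{k^2}\right).$$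
   Context: $\|\cdot\|$ is the Euclidean norm on $\mathbb{R}^d$ and the induced operator norm on matrices; $\mathbf{I}$ is the identity matrix. The notation $\mathcal{O}(\cdot)$ is the non-asymptotic big-O that hides all constants and keeps only the dependence on the iteration counter $k$: the conclusion means that there is a constant $C$ not depending on $k$ such that $f(x^k)-f^*\le C/k^2$ for all $k\ge 1$. *)

theory Defs
  imports "HOL-Analysis.Analysis"
begin

definition gradient :: "('a::real_inner \<Rightarrow> real) \<Rightarrow> 'a \<Rightarrow> 'a" where
  "gradient f x = (THE D. GDERIV f x :> D)"

definition hessian :: "(real^'n \<Rightarrow> real) \<Rightarrow> real^'n \<Rightarrow> real^'n^'n" where
  "hessian f x = jacobian (gradient f) (at x)"

(* Twice Frechet differentiable at every point; the second derivative need not be continuous. *)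
definition twice_differentiable :: "(real^'n \<Rightarrow> real) \<Rightarrow> bool" where
  "twice_differentiable f \<longleftrightarrow>
     f differentiable_on UNIV \<and> gradient f differentiable_on UNIV"

end

(* Write g for the gradient norm, r for the step and e for the suboptimality.  Since the Hessian is
   positive semidefinite, H |r| <= lam, hence g(k+1) <= 2 lam |r| <= 2 g(k) and e drops by at least
   2/3 lam |r|^2.  A step with g(k+1) >= g(k)/4 therefore decreases e by a multiple of e^(3/2), which
   increases 1/sqrt e by a constant; any other step divides g by 4.  If at least a third of the first
   k steps are of the first kind then e(k) = O(1/k^2); otherwise g(k) <= g(0) / 2^k, and
   e(k) <= D g(k) by convexity. *)
theory Submission
  imports Defs
begin

section \<open>Gradients, tangent planes and curvature of convex functions\<close>

lemma GDERIV_gradient: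
  fixes f :: "'a::euclidean_space \<Rightarrow> real"
  assumes "f differentiable at x"
  shows "GDERIV f x :> gradient f x"
proof -
  obtain f' where f': "(f has_derivative f') (at x)"
    using assms unfolding differentiable_def by blast
  interpret f': bounded_linear f'
    using f' by (rule has_derivative_bounded_linear)
  have "f' = (\<lambda>h. h \<bullet> adjoint f' 1)"
    using adjoint_works[OF f'.linear_axioms] by (auto simp: fun_eq_iff)
  with f' have D: "GDERIV f x :> adjoint f' 1"
    unfolding gderiv_def by simp
  have "E = adjoint f' 1" if "GDERIV f x :> E" for E
  proof -
    have "(\<lambda>h. h \<bullet> E) = (\<lambda>h. h \<bullet> adjoint f' 1)"
      using that D unfolding gderiv_def by (rule has_derivative_unique)
    then show ?thesis by (simp add: fun_eq_iff vector_eq_ldot)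
  qed
  with D show ?thesis
    unfolding gradient_def by (rule theI)
qed

text \<open>Restricting \<open>f\<close> to the line through \<open>u\<close> and \<open>v\<close>
  reduces this to the tangent inequality for convex functions of one real variable.\<close>

lemma convex_on_above_tangent_plane:
  fixes f :: "'a::real_inner \<Rightarrow> real"
  assumes "convex_on UNIV f" "GDERIV f u :> D"
  shows "f u + D \<bullet> (v - u) \<le> f v"
proof -
  define p where "p = (\<lambda>t::real. u + t *\<^sub>R (v - u))"
  have "convex_on UNIV (f \<circ> p)"
  proof (rule convex_onI)
    fix t a b :: real
    assume "0 < t" "t < 1"
    have "p ((1 - t) *\<^sub>R a + t *\<^sub>R b) = (1 - t) *\<^sub>R p a + t *\<^sub>R p b"
      by (simp add: p_def algebra_simps)
    then show "(f \<circ> p) ((1 - t) *\<^sub>R a + t *\<^sub>R b) \<le> (1 - t) * (f \<circ> p) a + t * (f \<circ> p) b"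
      using convex_onD[OF assms(1), of t "p a" "p b"] \<open>0 < t\<close> \<open>t < 1\<close> by simp
  qed simp
  moreover have "((f \<circ> p) has_real_derivative D \<bullet> (v - u)) (at 0)"
  proof -
    have "(p has_derivative (\<lambda>t. t *\<^sub>R (v - u))) (at 0)"
      unfolding p_def by (auto intro!: derivative_eq_intros)
    moreover have "(f has_derivative (\<lambda>h. h \<bullet> D)) (at (p 0))"
      using assms(2) by (simp add: gderiv_def p_def)
    ultimately have "((f \<circ> p) has_derivative (\<lambda>h. h \<bullet> D) \<circ> (\<lambda>t. t *\<^sub>R (v - u))) (at 0)"
      by (rule diff_chain_at)
    moreover have "(\<lambda>h. h \<bullet> D) \<circ> (\<lambda>t. t *\<^sub>R (v - u)) = (*) (D \<bullet> (v - u))"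
      by (auto simp: fun_eq_iff inner_commute)
    ultimately show ?thesis
      by (simp add: has_field_derivative_def)
  qed
  ultimately have "(f \<circ> p) 1 - (f \<circ> p) 0 \<ge> (D \<bullet> (v - u)) * (1 - 0)"
    by (intro convex_on_imp_above_tangent[where A = UNIV]) (auto simp del: o_apply)
  then show ?thesis by (simp add: p_def)
qed

text \<open>Take v = t h, divide by t^2 and let t fall to 0: the cubic term vanishes. Fed with the
  gap between the cubic upper bound and the tangent plane, this gives positive semidefiniteness of
  the Hessian without differentiating twice along lines.\<close>

lemma positive_semidefinite_of_cubic_lower_bound:
  fixes B :: "real^'n^'n"
  assumes "\<And>v. 0 \<le> 1/2 * ((B *v v) \<bullet> v) + c * norm v ^ 3"
  shows "0 \<le> (B *v h) \<bullet> h"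
proof (rule tendsto_lowerbound)
  show "((\<lambda>t. (B *v h) \<bullet> h + 2 * c * norm h ^ 3 * t) \<longlongrightarrow> (B *v h) \<bullet> h) (at_right 0)"
    by (auto intro!: tendsto_eq_intros)
  show "\<forall>\<^sub>F t in at_right 0. 0 \<le> (B *v h) \<bullet> h + 2 * c * norm h ^ 3 * t"
    unfolding eventually_at_right_field
  proof (intro exI[of _ 1] conjI allI impI)
    fix t :: real assume "0 < t"
    have "0 \<le> t^2 * ((B *v h) \<bullet> h + 2 * c * norm h ^ 3 * t)"
      using assms[of "t *\<^sub>R h"] \<open>0 < t\<close>
      by (simp add: matrix_vector_mult_scaleR power2_eq_square power3_eq_cube algebra_simps)
    then show "0 \<le> (B *v h) \<bullet> h + 2 * c * norm h ^ 3 * t"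
      using \<open>0 < t\<close> by (simp add: zero_le_mult_iff)
  qed simp
qed simp

section \<open>Scalar sequences with 1/k^2 decay\<close>

lemma sqrt_recurrence_step:
  fixes a e e' m :: real
  assumes "0 \<le> a" "0 \<le> e" "0 \<le> e'" "0 \<le> m"
    and rec: "e'^2 \<le> e^2 - 2 * a * e^3" and bound: "e * (a * m) \<le> 1"
  shows "e' * (a * (m + 1)) \<le> 1"
\<comment> \<open>In the application \<open>e\<close> is the square root of the suboptimality. The
  recurrence makes 1/e grow by at least \<open>a\<close>; the bound e <= 1/(a m) is kept as a
  product so that it also makes sense for \<open>e = 0\<close> and \<open>m = 0\<close>.\<close>
proof (cases "e = 0")
  case True
  with rec have "e' = 0" by simp
  then show ?thesis by simp
next
  case False
  with assms have "e > 0" by simp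
  have "e^2 * (2 * a * e) = 2 * a * e^3"
    by (simp add: power2_eq_square power3_eq_cube)
  then have "e^2 * (2 * a * e) \<le> e^2 * 1"
    using rec zero_le_power2[of e'] by linarith
  then have small: "2 * a * e \<le> 1" using \<open>e > 0\<close> by (simp only: mult_le_cancel_left) auto
  have "e'^2 \<le> (e * (1 - a * e))^2"
  proof -
    have "(e * (1 - a * e))^2 = e^2 - 2 * a * e^3 + (a * e^2)^2"
      by (simp add: power2_eq_square power3_eq_cube algebra_simps)
    then show ?thesis using rec zero_le_power2[of "a * e^2"] by linarith
  qed
  then have e': "e' \<le> e * (1 - a * e)"
    by (rule power2_le_imp_le) (use small \<open>e > 0\<close> assms in auto)
  have "e' * (a * (m + 1)) \<le> e * (1 - a * e) * (a * (m + 1))"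
    using e' assms by (intro mult_right_mono) auto
  also have "\<dots> = (e * (a * m) + a * e) * (1 - a * e)" by (simp add: algebra_simps)
  also have "\<dots> \<le> (1 + a * e) * (1 - a * e)"
    using bound small assms by (intro mult_right_mono) auto
  also have "\<dots> = 1 - (a * e)^2" by (simp add: power2_eq_square algebra_simps)
  also have "\<dots> \<le> 1" by simp
  finally show ?thesis .
qed

lemma square_le_exp2: "(real k)^2 \<le> 3 * 2 ^ k"
proof -
  \<comment> \<open>The extra terms make the induction close: doubling the left side absorbs its own
    increment.\<close>
  have "(real k)^2 + 2 * real k + 3 \<le> 3 * 2 ^ k"
  proof (induction k)
    case (Suc k)
    have "(real (Suc k))^2 + 2 * real (Suc k) + 3 = (real k)^2 + 4 * real k + 6"
      by (simp add: power2_eq_square algebra_simps)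
    also have "\<dots> \<le> 2 * ((real k)^2 + 2 * real k + 3)" by simp
    also have "\<dots> \<le> 3 * 2 ^ Suc k" using Suc.IH by simp
    finally show ?case .
  qed simp
  then show ?thesis by simp
qed

text \<open>Here \<open>e\<close> plays the square root of the suboptimality, so e^3 is its 3/2
  power. The sign of \<open>g\<close> is not assumed, hence the absolute value of
  \<open>g 0\<close>.\<close>

lemma inverse_square_rate:
  fixes e g :: "nat \<Rightarrow> real"
  assumes "a > 0" "D \<ge> 0"
    and e_nonneg: "\<And>k. 0 \<le> e k"
    and e_decr: "\<And>k. e (Suc k) \<le> e k"
    and e_le: "\<And>k. (e k)^2 \<le> D * g k"
    and g_double: "\<And>k. g (Suc k) \<le> 2 * g k"
    and dichotomy: "\<And>k. 4 * g (Suc k) \<le> g k \<or> (e (Suc k))^2 \<le> (e k)^2 - 2 * a * (e k)^3"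
  shows "(e k)^2 * (real k)^2 \<le> 9 / a^2 + 3 * D * \<bar>g 0\<bar>"
proof -
  \<comment> \<open>\<open>m\<close> counts the steps on which \<open>g\<close> is not divided by \<open>4\<close>.\<close>
  have "\<exists>m. e k * (a * real m) \<le> 1 \<and> g k * 4 ^ k \<le> \<bar>g 0\<bar> * 8 ^ m"
  proof (induction k)
    case 0
    show ?case by (rule exI[of _ 0]) auto
  next
    case (Suc k)
    then obtain m where m: "e k * (a * real m) \<le> 1" "g k * 4 ^ k \<le> \<bar>g 0\<bar> * 8 ^ m" by blast
    show ?case
    proof (cases "4 * g (Suc k) \<le> g k")
      case True
      have "e (Suc k) * (a * real m) \<le> e k * (a * real m)"
        using e_decr \<open>a > 0\<close> by (intro mult_right_mono) auto
      moreover have "g (Suc k) * 4 ^ Suc k \<le> g k * 4 ^ k"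
        using True by simp
      ultimately show ?thesis using m by (intro exI[of _ m]) linarith
    next
      case False
      then have "e (Suc k) * (a * (real m + 1)) \<le> 1"
        using dichotomy[of k] m(1) e_nonneg \<open>a > 0\<close> by (intro sqrt_recurrence_step[of a "e k"]) auto
      \<comment> \<open>\<open>g\<close> at most doubles while the weight gains a factor 4; the
        resulting 8 is paid for by one increment of \<open>m\<close>.\<close>
      moreover have "g (Suc k) * 4 ^ Suc k \<le> 8 * (g k * 4 ^ k)"
        using g_double[of k] by simp
      then have "g (Suc k) * 4 ^ Suc k \<le> \<bar>g 0\<bar> * 8 ^ Suc m"
        using m(2) unfolding power_Suc[of 8] by linarith
      ultimately show ?thesis
        by (intro exI[of _ "Suc m"]) (simp add: add.commute)
    qed
  qed
  then obtain m where m: "e k * (a * real m) \<le> 1" "g k * 4 ^ k \<le> \<bar>g 0\<bar> * 8 ^ m" by blast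
  show ?thesis
  \<comment> \<open>The threshold comes from 8^m = 2^(3m): either \<open>m\<close> is at least k/3
    and the bound on \<open>e\<close> suffices, or 8^m <= 2^k and \<open>g k\<close> is at most |g
    0| / 2^k.\<close>
  proof (cases "k \<le> 3 * m")
    case True
    then have "real k \<le> 3 * real m" by linarith
    then have "e k * a * real k \<le> e k * a * (3 * real m)"
      using e_nonneg \<open>a > 0\<close> by (intro mult_left_mono) auto
    also have "\<dots> \<le> 3" using m(1) by (simp add: algebra_simps)
    finally have "(e k * a * real k)^2 \<le> 3^2"
      using e_nonneg \<open>a > 0\<close> by (intro power_mono) auto
    then have "(e k)^2 * (real k)^2 \<le> 9 / a^2"
      using \<open>a > 0\<close> by (simp add: field_simps)
    then show ?thesis using \<open>D \<ge> 0\<close> by (simp add: add_increasing2)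
  next
    case False
    then have "(2::real) ^ (3 * m) \<le> 2 ^ k" by (intro power_increasing) auto
    then have "\<bar>g 0\<bar> * 8 ^ m \<le> \<bar>g 0\<bar> * 2 ^ k"
      by (intro mult_left_mono) (auto simp: power_mult)
    with m(2) have "(g k * 2 ^ k) * 2 ^ k \<le> \<bar>g 0\<bar> * 2 ^ k"
      by (simp add: power_mult_distrib[symmetric] mult.assoc)
    then have g: "g k * 2 ^ k \<le> \<bar>g 0\<bar>"
      by (rule mult_right_le_imp_le) simp
    have "(e k)^2 * (real k)^2 \<le> (e k)^2 * (3 * 2 ^ k)"
      by (intro mult_left_mono square_le_exp2) auto
    also have "\<dots> \<le> D * g k * (3 * 2 ^ k)"
      using e_le by (intro mult_right_mono) auto
    also have "\<dots> = 3 * D * (g k * 2 ^ k)" by simp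
    also have "\<dots> \<le> 3 * D * \<bar>g 0\<bar>"
      using g \<open>D \<ge> 0\<close> by (intro mult_left_mono) auto
    finally show ?thesis by (simp add: add_increasing)
  qed
qed

section \<open>A single regularized Newton step\<close>

lemma matrix_inv_solves:
  fixes A :: "real^'n^'n"
  assumes "invertible A"
  shows "A *v (matrix_inv A *v b) = b"
proof -
  have "A ** matrix_inv A = mat 1"
    using someI_ex[OF assms[unfolded invertible_def]] unfolding matrix_inv_def by blast
  then show ?thesis by (simp add: matrix_vector_mul_assoc)
qed

text \<open>Pairing (B + lam I) s = -g with \<open>s\<close> gives lam |s| <= |g|. Since lam^2 = H
  |g|, this yields H |s| <= lam, so the regularization dominates both Taylor errors.\<close>

lemma regularized_newton_step:
  fixes B :: "real^'n^'n" and g g' s :: "real^'n"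
  assumes psd: "0 \<le> (B *v s) \<bullet> s" and "H > 0"
    and lam: "lam = sqrt (H * norm g)"
    and inv: "invertible (B + lam *\<^sub>R mat 1)"
    and s: "s = - (matrix_inv (B + lam *\<^sub>R mat 1) *v g)"
    and cubic: "f' \<le> f + g \<bullet> s + 1/2 * ((B *v s) \<bullet> s) + H/3 * norm s ^ 3"
    and grad: "norm (g' - g - B *v s) \<le> H * (norm s)\<^sup>2"
  shows "lam * norm s \<le> norm g" "norm g' \<le> 2 * lam * norm s" "f' \<le> f - 2/3 * lam * (norm s)\<^sup>2"
proof -
  have lam2: "lam^2 = H * norm g" and "lam \<ge> 0"
    using \<open>H > 0\<close> by (simp_all add: lam)
  have "(B + lam *\<^sub>R mat 1) *v s = - g"
    using matrix_inv_solves[OF inv, of g] by (simp add: s linear_neg)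
  then have eq: "B *v s + lam *\<^sub>R s = - g"
    by (simp add: matrix_vector_mult_add_rdistrib scaleR_matrix_vector_assoc[symmetric])
  then have gs: "g \<bullet> s = - ((B *v s) \<bullet> s) - lam * (norm s)^2"
    by (metis add.inverse_inverse diff_conv_add_uminus inner_add_left inner_minus_left
        inner_scaleR_left minus_add_distrib power2_norm_eq_inner)
  have "lam * norm s * norm s \<le> norm g * norm s"
    using gs psd norm_cauchy_schwarz[of "- g" s] by (simp add: power2_eq_square)
  then show 1: "lam * norm s \<le> norm g"
    by (cases "s = 0") auto
  have Hs: "H * norm s \<le> lam"
  \<comment> \<open>Without regularization the gradient vanishes, and then so does the step.\<close>
  proof (cases "lam = 0")
    case True
    then have "g = 0" using lam2 \<open>H > 0\<close> by simp
    then show ?thesis using s True by simp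
  next
    case False
    with \<open>lam \<ge> 0\<close> have "lam > 0" by simp
    have "lam * (H * norm s) \<le> lam * lam"
      using mult_left_mono[OF 1, of H] \<open>H > 0\<close> lam2 by (simp add: power2_eq_square mult_ac)
    then show ?thesis using \<open>lam > 0\<close> by (simp add: mult_le_cancel_left)
  qed
  have Hs2: "H * (norm s)^2 \<le> lam * norm s"
    using mult_right_mono[OF Hs, of "norm s"] by (simp add: power2_eq_square mult_ac)
  \<comment> \<open>By the Newton equation g + B s = -lam s, so the new gradient is the Taylor error
    minus lam s, each of norm at most lam |s|.\<close>
  have "g' = (g' - g - B *v s) - lam *\<^sub>R s"
    using eq by (simp add: algebra_simps eq_neg_iff_add_eq_0)
  then have "norm g' \<le> norm (g' - g - B *v s) + norm (lam *\<^sub>R s)"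
    by (metis norm_triangle_ineq4)
  then show "norm g' \<le> 2 * lam * norm s"
    using grad Hs2 \<open>lam \<ge> 0\<close> by simp
  \<comment> \<open>The linear and quadratic terms contribute at most -lam |s|^2; the cubic error
    returns at most a third of that, leaving 2/3.\<close>
  have "H * norm s ^ 3 \<le> lam * (norm s)^2"
    using mult_right_mono[OF Hs2, of "norm s"] by (simp add: power2_eq_square power3_eq_cube mult_ac)
  then show "f' \<le> f - 2/3 * lam * (norm s)\<^sup>2"
    using cubic gs psd by (simp add: algebra_simps)
qed

section \<open>The rate for the Newton iterates\<close>

theorem theorem1:
  fixes f :: "real^'n \<Rightarrow> real"
    and H D fstar :: real
    and x0 xstar :: "real^'n"
    and x :: "nat \<Rightarrow> real^'n"
    and lam :: "nat \<Rightarrow> real"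
  assumes convex: "convex_on UNIV f"
    and twice_diff: "twice_differentiable f"
    and H_pos: "H > 0"
    and cubic_bound: "\<And>u v. f v \<le> f u + gradient f u \<bullet> (v - u)
          + 1/2 * ((hessian f u *v (v - u)) \<bullet> (v - u)) + H/3 * norm (v - u) ^ 3"
    and gradient_bound: "\<And>u v. norm (gradient f v - gradient f u - hessian f u *v (v - u))
          \<le> H * (norm (u - v))\<^sup>2"
    and minimum: "\<And>u. fstar \<le> f u"
    and minimizer: "f xstar = fstar"
    and D_pos: "D > 0"
    and level_set: "\<And>u. f u \<le> f x0 \<Longrightarrow> norm (u - xstar) \<le> D"
    and x_0: "x 0 = x0"
    and lam: "\<And>k. lam k = sqrt (H * norm (gradient f (x k)))"
    and invertible: "\<And>k. invertible (hessian f (x k) + lam k *\<^sub>R mat 1)"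
    and x_Suc: "\<And>k. x (Suc k) =
          x k - matrix_inv (hessian f (x k) + lam k *\<^sub>R mat 1) *v gradient f (x k)"
  shows "\<exists>C. \<forall>k\<ge>1. f (x k) - fstar \<le> C / (real k)\<^sup>2"
proof -
  define s where "s = (\<lambda>k. x (Suc k) - x k)"
  define g where "g = (\<lambda>k. norm (gradient f (x k)))"
  define e where "e = (\<lambda>k. sqrt (f (x k) - fstar))"
  \<comment> \<open>Chosen so that 2 a cancels the factor 96 sqrt H (sqrt D)^3 by which a slow step
    bounds e^3 in terms of the decrease of e^2.\<close>
  define a where "a = 1 / (192 * sqrt H * (sqrt D)^3)"
  have "a > 0" using H_pos D_pos by (simp add: a_def)
  have lower: "f u + gradient f u \<bullet> (v - u) \<le> f v" for u v
    using twice_diff unfolding twice_differentiable_def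
    by (intro convex_on_above_tangent_plane[OF convex] GDERIV_gradient)
       (simp add: differentiable_on_def)
  have psd: "0 \<le> (hessian f u *v h) \<bullet> h" for u h
  proof (rule positive_semidefinite_of_cubic_lower_bound)
    show "0 \<le> 1/2 * ((hessian f u *v v) \<bullet> v) + H/3 * norm v ^ 3" for v
      using lower[of u "u + v"] cubic_bound[where u = u and v = "u + v"] by simp
  qed
  have step: "lam k * norm (s k) \<le> g k \<and> g (Suc k) \<le> 2 * lam k * norm (s k)
      \<and> f (x (Suc k)) \<le> f (x k) - 2/3 * lam k * (norm (s k))\<^sup>2" for k
    unfolding g_def
    using regularized_newton_step[OF psd H_pos lam invertible,
        where s = "s k" and f' = "f (x (Suc k))" and g' = "gradient f (x (Suc k))" and f = "f (x k)"]
      cubic_bound[where u = "x k" and v = "x (Suc k)"]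
      gradient_bound[where u = "x k" and v = "x (Suc k)"]
    by (simp add: s_def norm_minus_commute x_Suc[of k])
  have lam_nonneg: "0 \<le> lam k" for k
    using H_pos by (simp add: lam)
  have descent: "f (x (Suc k)) \<le> f (x k)" for k
  proof -
    have "0 \<le> 2/3 * lam k * (norm (s k))\<^sup>2" using lam_nonneg[of k] by simp
    then show ?thesis using step[of k] by linarith
  qed
  have "f (x k) \<le> f x0" for k
    by (induction k) (use x_0 descent order_trans in auto)
  then have close: "norm (x k - xstar) \<le> D" for k
    by (rule level_set)
  have e2: "(e k)^2 = f (x k) - fstar" for k
    using minimum by (simp add: e_def)
  \<comment> \<open>The tangent plane at \<open>x k\<close>, evaluated at \<open>xstar\<close>,
    bounds the suboptimality; the iterates stay in the initial level set, so the distance is at most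
    \<open>D\<close>.\<close>
  have e_le: "(e k)^2 \<le> D * g k" for k
  proof -
    have "f (x k) - fstar \<le> gradient f (x k) \<bullet> (x k - xstar)"
      using lower[of "x k" xstar] minimizer by (simp add: inner_diff_right)
    also have "\<dots> \<le> g k * norm (x k - xstar)"
      unfolding g_def by (rule norm_cauchy_schwarz)
    also have "\<dots> \<le> g k * D"
      using close by (intro mult_left_mono) (auto simp: g_def)
    finally show ?thesis by (simp add: e2 mult.commute)
  qed
  have dichotomy: "4 * g (Suc k) \<le> g k \<or> (e (Suc k))^2 \<le> (e k)^2 - 2 * a * (e k)^3" for k
  proof (rule disjCI)
    assume "\<not> (e (Suc k))^2 \<le> (e k)^2 - 2 * a * (e k)^3"
    then have slow: "(e k)^2 - (e (Suc k))^2 < 2 * a * (e k)^3" by simp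
    show "4 * g (Suc k) \<le> g k"
    proof (rule ccontr)
      assume "\<not> 4 * g (Suc k) \<le> g k"
      then have large: "g k < 4 * g (Suc k)" by simp
      \<comment> \<open>With this root, \<open>lam k\<close> is sqrt H times q, and fractional
        powers of \<open>g k\<close> become integer powers of q.\<close>
      define q where "q = sqrt (g k)"
      have q2: "q^2 = g k" and "q \<ge> 0" by (simp_all add: q_def g_def)
      have lam_q: "lam k = sqrt H * q" by (simp add: lam q_def g_def real_sqrt_mult)
      have "g k \<le> 8 * (lam k * norm (s k))"
        using large step[of k] by linarith
      then have "(g k)^2 \<le> (8 * (lam k * norm (s k)))^2"
        by (intro power_mono) (auto simp: g_def)
      \<comment> \<open>Splitting 64 as 96 times 2/3 exposes the guaranteed decrease of
        \<open>f\<close>.\<close>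
      also have "\<dots> = 96 * lam k * (2/3 * lam k * (norm (s k))^2)"
        by (simp add: power2_eq_square)
      also have "\<dots> \<le> 96 * lam k * ((e k)^2 - (e (Suc k))^2)"
        using step[of k] lam_nonneg[of k] by (intro mult_left_mono) (auto simp: e2)
      finally have drop: "q * q^3 \<le> q * (96 * sqrt H * ((e k)^2 - (e (Suc k))^2))"
        by (simp add: lam_q q2[symmetric] power2_eq_square power3_eq_cube mult_ac)
      \<comment> \<open>Needed to cancel q in \<open>drop\<close>: a zero gradient would force the
        next gradient to be zero as well, contradicting \<open>large\<close>.\<close>
      have "q > 0"
      proof (rule ccontr)
        assume "\<not> q > 0"
        then have "g k = 0" using \<open>q \<ge> 0\<close> q2 by simp
        then have "g (Suc k) \<le> 0"
          using step[of k] by linarith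
        then show False using large \<open>g k = 0\<close> by simp
      qed
      then have q3: "q^3 \<le> 96 * sqrt H * ((e k)^2 - (e (Suc k))^2)"
        using drop by (rule mult_left_le_imp_le[rotated])
      have "e k \<le> sqrt D * q"
        by (rule power2_le_imp_le) (use e_le[of k] D_pos \<open>q \<ge> 0\<close> q2 in \<open>auto simp: power_mult_distrib\<close>)
      then have "(e k)^3 \<le> (sqrt D * q)^3"
        using minimum by (intro power_mono) (auto simp: e_def)
      also have "\<dots> = (sqrt D)^3 * q^3" by (rule power_mult_distrib)
      also have "\<dots> \<le> (sqrt D)^3 * (96 * sqrt H * ((e k)^2 - (e (Suc k))^2))"
        using q3 D_pos by (intro mult_left_mono) auto
      finally have "2 * a * (e k)^3 \<le> 2 * a * ((sqrt D)^3 * (96 * sqrt H * ((e k)^2 - (e (Suc k))^2)))"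
        using \<open>a > 0\<close> by (intro mult_left_mono) auto
      also have "\<dots> = (e k)^2 - (e (Suc k))^2"
        using H_pos D_pos by (simp add: a_def)
      finally show False using slow by simp
    qed
  qed
  have g_double: "g (Suc k) \<le> 2 * g k" for k
    using step[of k] by linarith
  have "e (Suc k) \<le> e k" for k
    using descent by (simp add: e_def)
  then have rate: "(e k)^2 * (real k)^2 \<le> 9 / a^2 + 3 * D * \<bar>g 0\<bar>" for k
    using minimum D_pos
    by (intro inverse_square_rate \<open>a > 0\<close> e_le g_double dichotomy) (auto simp: e_def)
  show ?thesis
  proof (intro exI allI impI)
    fix k :: nat assume "1 \<le> k"
    then show "f (x k) - fstar \<le> (9 / a^2 + 3 * D * \<bar>g 0\<bar>) / (real k)\<^sup>2"
      using rate[of k] by (simp add: e2 pos_le_divide_eq)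
  qed
qed

end
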